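(* Let $X,Y$ be topological spaces and let $\phi:X\to Y$ be a closed $H^*$-irresolute injection. If $Y$ is $H^*$-normal, then $X$ is $H^*$-normal.
   Context: No separation axioms are assumed. Let $X$ be a topological space and $A\subseteq X$. $A$ is semi-closed if $\operatorname{int}(\operatorname{cl}(A))\subseteq A$, and semi-open if its complement is semi-closed; $s\text{-}\operatorname{cl}(A)$ is the intersection of all semi-closed sets containing $A$. $A$ is $w$-closed if $\operatorname{cl}(A)\subseteq U$ whenever $A\subseteq U$ and $U$ is semi-open; $w$-open means complement of $w$-closed. $A$ is $h$-closed if $s\text{-}\operatorname{cl}(A)\subseteq U$ whenever $A\subseteq U$ and $U$ is $w$-open; $h\text{-}\operatorname{cl}(A)$ is the intersection of all $h$-closed sets containing $A$. A set $V$ is an $\alpha^*$-set if $\operatorname{int}(\operatorname{cl}(\operatorname{int}(V)))=\operatorname{int}(V)$; a $C$-set is a set of the form $U\cap V$ with $U$ open and $V$ an $\alpha^*$-set. $A$ is $hCg$-closed if $h\text{-}\operatorname{cl}(A)\subseteq U$ whenever $A\subseteq U$ and $U$ is a $C$-set; $hCg$-open means complement of $hCg$-closed. $A$ is $H^*$-closed if $h\text{-}\operatorname{cl}(A)\subseteq U$ whenever $A\subseteq U$ and $U$ is $hCg$-open; $H^*$-open means complement of $H^*$-closed. $X$ is $H^*$-normal if for any pair of disjoint closed sets $A,B\subseteq X$ there exist disjoint $H^*$-open sets $U,V$ with $A\subseteq U$ and $B\subseteq V$. A function $\phi:X\to Y$ is closed if it maps closed sets to closed sets; it is $H^*$-irresolute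 if $\phi^{-1}(V)$ is $H^*$-open in $X$ for every $H^*$-open set $V\subseteq Y$. *)

theory Defs
  imports "HOL-Analysis.Abstract_Topology"
begin

text \<open>
  All notions are relative to an abstract topology \<open>X\<close>: every predicate below includes
  \<open>A \<subseteq> topspace X\<close>, and complements are taken in \<open>topspace X\<close>. The two closure operators are
  only meaningful for subsets of \<open>topspace X\<close>, and are only applied to such sets. For these the
  intersected family is nonempty, since \<open>topspace X\<close> is both semi-closed and \<open>h\<close>-closed.
\<close>

definition semi_closedin :: "'a topology \<Rightarrow> 'a set \<Rightarrow> bool" where
  "semi_closedin X A \<longleftrightarrow> A \<subseteq> topspace X \<and> X interior_of (X closure_of A) \<subseteq> A"

definition semi_openin :: "'a topology \<Rightarrow> 'a set \<Rightarrow> bool" where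
  "semi_openin X A \<longleftrightarrow> A \<subseteq> topspace X \<and> semi_closedin X (topspace X - A)"

definition semi_closure_of :: "'a topology \<Rightarrow> 'a set \<Rightarrow> 'a set" where
  "semi_closure_of X A = \<Inter>{F. semi_closedin X F \<and> A \<subseteq> F}"

definition w_closedin :: "'a topology \<Rightarrow> 'a set \<Rightarrow> bool" where
  "w_closedin X A \<longleftrightarrow> A \<subseteq> topspace X \<and>
     (\<forall>U. semi_openin X U \<and> A \<subseteq> U \<longrightarrow> X closure_of A \<subseteq> U)"

definition w_openin :: "'a topology \<Rightarrow> 'a set \<Rightarrow> bool" where
  "w_openin X A \<longleftrightarrow> A \<subseteq> topspace X \<and> w_closedin X (topspace X - A)"

definition h_closedin :: "'a topology \<Rightarrow> 'a set \<Rightarrow> bool" where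
  "h_closedin X A \<longleftrightarrow> A \<subseteq> topspace X \<and>
     (\<forall>U. w_openin X U \<and> A \<subseteq> U \<longrightarrow> semi_closure_of X A \<subseteq> U)"

definition h_closure_of :: "'a topology \<Rightarrow> 'a set \<Rightarrow> 'a set" where
  "h_closure_of X A = \<Inter>{F. h_closedin X F \<and> A \<subseteq> F}"

definition alpha_star_set :: "'a topology \<Rightarrow> 'a set \<Rightarrow> bool" where
  "alpha_star_set X V \<longleftrightarrow> V \<subseteq> topspace X \<and>
     X interior_of (X closure_of (X interior_of V)) = X interior_of V"

definition C_set :: "'a topology \<Rightarrow> 'a set \<Rightarrow> bool" where
  "C_set X A \<longleftrightarrow> (\<exists>U V. openin X U \<and> alpha_star_set X V \<and> A = U \<inter> V)"

definition hCg_closedin :: "'a topology \<Rightarrow> 'a set \<Rightarrow> bool" where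
  "hCg_closedin X A \<longleftrightarrow> A \<subseteq> topspace X \<and>
     (\<forall>U. C_set X U \<and> A \<subseteq> U \<longrightarrow> h_closure_of X A \<subseteq> U)"

definition hCg_openin :: "'a topology \<Rightarrow> 'a set \<Rightarrow> bool" where
  "hCg_openin X A \<longleftrightarrow> A \<subseteq> topspace X \<and> hCg_closedin X (topspace X - A)"

definition H_star_closedin :: "'a topology \<Rightarrow> 'a set \<Rightarrow> bool" where
  "H_star_closedin X A \<longleftrightarrow> A \<subseteq> topspace X \<and>
     (\<forall>U. hCg_openin X U \<and> A \<subseteq> U \<longrightarrow> h_closure_of X A \<subseteq> U)"

definition H_star_openin :: "'a topology \<Rightarrow> 'a set \<Rightarrow> bool" where
  "H_star_openin X A \<longleftrightarrow> A \<subseteq> topspace X \<and> H_star_closedin X (topspace X - A)"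

definition H_star_normal_space :: "'a topology \<Rightarrow> bool" where
  "H_star_normal_space X \<longleftrightarrow>
     (\<forall>A B. closedin X A \<and> closedin X B \<and> disjnt A B \<longrightarrow>
        (\<exists>U V. H_star_openin X U \<and> H_star_openin X V \<and> disjnt U V \<and> A \<subseteq> U \<and> B \<subseteq> V))"

definition H_star_irresolute_map :: "'a topology \<Rightarrow> 'b topology \<Rightarrow> ('a \<Rightarrow> 'b) \<Rightarrow> bool" where
  "H_star_irresolute_map X Y f \<longleftrightarrow> f \<in> topspace X \<rightarrow> topspace Y \<and>
     (\<forall>V. H_star_openin Y V \<longrightarrow> H_star_openin X {x \<in> topspace X. f x \<in> V})"

end

theory Submission
  imports Defs
begin

text \<open>Separation is pulled back along \<open>\<phi>\<close>. Disjoint closed sets of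
  \<open>X\<close> have closed images because \<open>\<phi>\<close> is a closed map, and disjoint
  images because it is injective. \<open>H*\<close>-normality of \<open>Y\<close> separates these
  images, and irresoluteness makes the preimages of the separating sets \<open>H*\<close>-open.
  Taking preimages preserves disjointness and returns supersets of the original sets.\<close>

theorem corollary4p4:
  fixes X :: "'a topology" and Y :: "'b topology" and \<phi> :: "'a \<Rightarrow> 'b"
  assumes "closed_map X Y \<phi>"
    and "H_star_irresolute_map X Y \<phi>"
    and "inj_on \<phi> (topspace X)"
    and "H_star_normal_space Y"
  shows "H_star_normal_space X"
  unfolding H_star_normal_space_def
proof (intro allI impI, elim conjE)
  fix A B
  assume A: "closedin X A" and B: "closedin X B" and "disjnt A B"
  have sub: "A \<subseteq> topspace X" "B \<subseteq> topspace X"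
    using A B by (auto dest: closedin_subset)
  have "closedin Y (\<phi> ` A)" "closedin Y (\<phi> ` B)"
    using assms(1) A B by (auto simp: closed_map_def)
  \<comment> \<open>A common image point would come from one point of \<open>A\<close> and one of
    \<open>B\<close>; injectivity, available only on \<open>topspace X\<close> (hence
    \<open>sub\<close>), would identify them.\<close>
  moreover have "disjnt (\<phi> ` A) (\<phi> ` B)"
    using \<open>disjnt A B\<close> assms(3) sub by (auto simp: disjnt_iff dest: inj_onD)
  ultimately obtain U V where UV: "H_star_openin Y U" "H_star_openin Y V" "disjnt U V"
      "\<phi> ` A \<subseteq> U" "\<phi> ` B \<subseteq> V"
    using assms(4) unfolding H_star_normal_space_def by meson
  \<comment> \<open>The preimage is cut down to \<open>topspace X\<close>, as in
    \<open>H_star_irresolute_map_def\<close>; \<open>A\<close> and \<open>B\<close> still lie in it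
    by \<open>sub\<close>.\<close>
  let ?pre = "\<lambda>W. {x \<in> topspace X. \<phi> x \<in> W}"
  have "H_star_openin X (?pre U)" "H_star_openin X (?pre V)"
    using assms(2) UV(1,2) by (auto simp: H_star_irresolute_map_def)
  moreover have "disjnt (?pre U) (?pre V)" "A \<subseteq> ?pre U" "B \<subseteq> ?pre V"
    using UV(3-5) sub by (auto simp: disjnt_iff)
  ultimately show "\<exists>U V. H_star_openin X U \<and> H_star_openin X V \<and> disjnt U V \<and> A \<subseteq> U \<and> B \<subseteq> V"
    by blast
qed

end
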